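(* Let $a<\tau<b$ be real numbers and let $f:[a,b]\to\mathbb{C}$ be in $L^1([a,b])$. Define $g(x):=f(x+\tau)$ for $x\in[a-\tau,b-\tau]$, put $r:=\min(\tau-a,\,b-\tau)>0$, and let $g_o(t):=\tfrac12\bigl(g(t)-g(-t)\bigr)$ for $t\in[-r,r]$ be the odd part of $g$. Assume that $t\mapsto g_o(t)/t$ belongs to $L^1([-r,r])$. Then the Cauchy principal value integral $$\mathrm{P.V.}\int_a^b\frac{f(t)}{t-\tau}\,dt$$ exists.
   Context: For $f$ defined on $[a,b]$ and $\tau\in(a,b)$, the Cauchy principal value integral of $f$ based at $\tau$ is $$\mathrm{P.V.}\int_a^b\frac{f(t)}{t-\tau}\,dt:=\lim_{\delta\to0^+}\left(\int_a^{\tau-\delta}\frac{f(t)}{t-\tau}\,dt+\int_{\tau+\delta}^b\frac{f(t)}{t-\tau}\,dt\right),$$ and it is said to exist when this limit exists. *)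

theory Defs
  imports "HOL-Analysis.Analysis"
begin

(* The eventual integrability of the two truncated integrands is demanded explicitly
   because a non-integrable function would otherwise be assigned the integral 0. *)
definition has_cauchy_pv :: "(real \<Rightarrow> complex) \<Rightarrow> real \<Rightarrow> real \<Rightarrow> real \<Rightarrow> complex \<Rightarrow> bool" where
  "has_cauchy_pv f a b \<tau> L \<longleftrightarrow>
     (\<forall>\<^sub>F \<delta> in at_right 0.
        set_integrable lebesgue {a..\<tau> - \<delta>} (\<lambda>t. f t / of_real (t - \<tau>)) \<and>
        set_integrable lebesgue {\<tau> + \<delta>..b} (\<lambda>t. f t / of_real (t - \<tau>))) \<and>
     ((\<lambda>\<delta>. (LINT t:{a..\<tau> - \<delta>}|lebesgue. f t / of_real (t - \<tau>)) +
            (LINT t:{\<tau> + \<delta>..b}|lebesgue. f t / of_real (t - \<tau>)))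
       \<longlongrightarrow> L) (at_right 0)"

definition cauchy_pv_exists :: "(real \<Rightarrow> complex) \<Rightarrow> real \<Rightarrow> real \<Rightarrow> real \<Rightarrow> bool" where
  "cauchy_pv_exists f a b \<tau> \<longleftrightarrow> (\<exists>L. has_cauchy_pv f a b \<tau> L)"

end

(* Beyond the window of radius r around tau the two truncated integrals do not depend on delta.
   Inside the window, substituting t = tau + s and t = tau - s folds them into the integral of
   2 g_o(s)/s over [delta, r], which is continuous in delta up to delta = 0. *)
theory Submission
  imports Defs
begin

text \<open>On a compact interval that misses \<open>\<tau>\<close> the kernel
  \<open>1 / (t - \<tau>)\<close> is continuous, hence measurable and bounded, and a bounded
  measurable factor preserves absolute integrability.\<close>

lemma set_integrable_cauchy_kernel:
  fixes f :: "real \<Rightarrow> complex"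
  assumes f: "set_integrable lebesgue {a..b} f" and "\<tau> \<notin> {c..d}" and "{c..d} \<subseteq> {a..b}"
  shows "set_integrable lebesgue {c..d} (\<lambda>t. f t / of_real (t - \<tau>))"
proof -
  have fcd: "f absolutely_integrable_on {c..d}"
    using assms(3) by (intro set_integrable_subset[OF f]) auto
  have cont: "continuous_on {c..d} (\<lambda>t. 1 / complex_of_real (t - \<tau>))"
    using assms(2) by (intro continuous_intros) auto
  have "(\<lambda>t. 1 / complex_of_real (t - \<tau>) * f t) absolutely_integrable_on {c..d}"
  proof (rule absolutely_integrable_bounded_measurable_product[where h = "(*)"])
    show "bilinear ((*) :: complex \<Rightarrow> complex \<Rightarrow> complex)"
      by (simp add: bilinear_conv_bounded_bilinear bounded_bilinear_mult)
    show "(\<lambda>t. 1 / complex_of_real (t - \<tau>)) \<in> borel_measurable (lebesgue_on {c..d})"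
      using cont by (rule continuous_imp_measurable_on_sets_lebesgue) simp
    show "bounded ((\<lambda>t. 1 / complex_of_real (t - \<tau>)) ` {c..d})"
      using cont by (intro compact_imp_bounded compact_continuous_image) auto
  qed (use fcd in auto)
  then show ?thesis by simp
qed

theorem proposition3:
  fixes a b \<tau> r :: real and f g g\<^sub>o :: "real \<Rightarrow> complex"
  assumes "a < \<tau>" and "\<tau> < b"
    and "set_integrable lebesgue {a..b} f"
    and "\<And>x. x \<in> {a - \<tau>..b - \<tau>} \<Longrightarrow> g x = f (x + \<tau>)"
    and "r = min (\<tau> - a) (b - \<tau>)"
    and "\<And>t. t \<in> {-r..r} \<Longrightarrow> g\<^sub>o t = (1/2) * (g t - g (-t))"
    and "set_integrable lebesgue {-r..r} (\<lambda>t. g\<^sub>o t / of_real t)"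
  shows "cauchy_pv_exists f a b \<tau>"
proof -
  define h where "h = (\<lambda>t. f t / complex_of_real (t - \<tau>))"
  have fold_h: "(\<lambda>t. f t / complex_of_real (t - \<tau>)) = h" "\<And>t. f t / complex_of_real (t - \<tau>) = h t"
    by (simp_all add: h_def)
  define q where "q = (\<lambda>t. g\<^sub>o t / complex_of_real t)"
  define I where "I = (\<lambda>\<delta>. 2 * integral {\<delta>..r} q)"
  \<comment> \<open>As \<open>r\<close> is the smaller of the distances from \<open>\<tau>\<close>
    to the endpoints, at least one of these two intervals is a single point and contributes
    0.\<close>
  define C where "C = integral {a..\<tau> - r} h + integral {\<tau> + r..b} h"
  have r: "0 < r" "a \<le> \<tau> - r" "\<tau> + r \<le> b" using assms(1,2,5) by auto
  have left: "set_integrable lebesgue {a..\<tau> - \<delta>} h"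
    and right: "set_integrable lebesgue {\<tau> + \<delta>..b} h" if "0 < \<delta>" for \<delta>
    unfolding h_def using that assms(1,2)
    by (intro set_integrable_cauchy_kernel[OF assms(3)]; auto)+
  have trunc: "(LINT t:{a..\<tau> - \<delta>}|lebesgue. h t) + (LINT t:{\<tau> + \<delta>..b}|lebesgue. h t) = C + I \<delta>"
    if \<delta>: "0 < \<delta>" "\<delta> < r" for \<delta>
  proof -
    \<comment> \<open>From here on the integrals are gauge integrals, for which shifting, reflecting
      and splitting of intervals are available.\<close>
    note L = set_lebesgue_integral_eq_integral[OF left[OF \<delta>(1)]]
      and R = set_lebesgue_integral_eq_integral[OF right[OF \<delta>(1)]]
    have Lh: "h integrable_on {\<tau> - r..\<tau> - \<delta>}" and Rh: "h integrable_on {\<tau> + \<delta>..\<tau> + r}"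
      using L(1) R(1) r by (auto intro: integrable_on_subinterval)
    \<comment> \<open>The shift by \<open>\<tau>\<close> leads to \<open>{-r..-\<delta>}\<close>,
      and the reflection then to \<open>{\<delta>..r}\<close>. Integrals over sets carry no
      orientation, so the reflection costs no sign.\<close>
    have Li: "((\<lambda>s. h (\<tau> - s)) has_integral integral {\<tau> - r..\<tau> - \<delta>} h) {\<delta>..r}"
      using has_integral_shift_real_ivl[OF integrable_integral[OF Lh], of \<tau>]
        has_integral_reflect_real[of "\<lambda>s. h (\<tau> - s)" _ r \<delta>] by (simp add: add.commute)
    have Ri: "((\<lambda>s. h (\<tau> + s)) has_integral integral {\<tau> + \<delta>..\<tau> + r} h) {\<delta>..r}"
      using has_integral_shift_real_ivl[OF integrable_integral[OF Rh], of \<tau>]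
      by (simp add: add.commute)
    \<comment> \<open>At \<open>\<tau> - s\<close> the denominator is \<open>-s\<close>; this sign
      turns the sum of the two values of \<open>h\<close> into a difference of values of
      \<open>f\<close>, which is twice the odd part.\<close>
    have "2 * q s = h (\<tau> - s) + h (\<tau> + s)" if "s \<in> {\<delta>..r}" for s
    proof -
      have "g s = f (\<tau> + s)" "g (-s) = f (\<tau> - s)" "g\<^sub>o s = (1/2) * (g s - g (-s))"
        using that \<delta> r assms(4)[of s] assms(4)[of "-s"] assms(6)[of s] by (auto simp: add.commute)
      then show ?thesis by (simp add: q_def h_def diff_divide_distrib)
    qed
    then have "((\<lambda>s. 2 * q s) has_integral
        integral {\<tau> - r..\<tau> - \<delta>} h + integral {\<tau> + \<delta>..\<tau> + r} h) {\<delta>..r}"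
      using has_integral_add[OF Li Ri] by (subst has_integral_cong) auto
    then have "I \<delta> = integral {\<tau> - r..\<tau> - \<delta>} h + integral {\<tau> + \<delta>..\<tau> + r} h"
      unfolding I_def by (metis integral_mult_right integral_unique)
    moreover have "integral {a..\<tau> - r} h + integral {\<tau> - r..\<tau> - \<delta>} h = integral {a..\<tau> - \<delta>} h"
      using r \<delta> L(1) by (intro Henstock_Kurzweil_Integration.integral_combine) auto
    moreover have "integral {\<tau> + \<delta>..\<tau> + r} h + integral {\<tau> + r..b} h = integral {\<tau> + \<delta>..b} h"
      using r \<delta> R(1) by (intro Henstock_Kurzweil_Integration.integral_combine) auto
    ultimately show ?thesis using L(2) R(2) by (simp add: C_def algebra_simps)
  qed
  \<comment> \<open>The hypothesis on \<open>g\<^sub>o\<close> enters here: \<open>q\<close> is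
    integrable right up to the singular point, so its integral is continuous in the lower limit at 0
    as well. The value \<open>q 0\<close>, which is 0 by the convention for division by zero, does
    not affect the integral.\<close>
  have "q integrable_on {0..r}"
    using set_lebesgue_integral_eq_integral(1)[OF assms(7)] r
    by (auto simp: q_def intro: integrable_on_subinterval)
  then have "continuous_on {0..r} (\<lambda>\<delta>. integral {\<delta>..r} q)"
    by (rule indefinite_integral_continuous_1')
  then have "((\<lambda>\<delta>. integral {\<delta>..r} q) \<longlongrightarrow> integral {0..r} q) (at_right 0)"
    using r(1) by (rule continuous_on_Icc_at_rightD)
  then have lim: "((\<lambda>\<delta>. C + I \<delta>) \<longlongrightarrow> C + I 0) (at_right 0)"
    unfolding I_def by (intro tendsto_intros)
  \<comment> \<open>The identity \<open>trunc\<close> needs the cut to lie strictly inside the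
    window, which holds for all small positive \<open>\<delta>\<close>.\<close>
  have ev: "\<forall>\<^sub>F \<delta> in at_right 0. 0 < \<delta> \<and> \<delta> < r"
    using eventually_at_right_real[OF r(1)] by simp
  have "has_cauchy_pv f a b \<tau> (C + I 0)"
    unfolding has_cauchy_pv_def fold_h
  proof
    show "\<forall>\<^sub>F \<delta> in at_right 0. set_integrable lebesgue {a..\<tau> - \<delta>} h \<and>
        set_integrable lebesgue {\<tau> + \<delta>..b} h"
      using ev by eventually_elim (simp add: left right)
    show "((\<lambda>\<delta>. (LINT t:{a..\<tau> - \<delta>}|lebesgue. h t) + (LINT t:{\<tau> + \<delta>..b}|lebesgue. h t))
        \<longlongrightarrow> C + I 0) (at_right 0)"
      using lim by (rule Lim_transform_eventually) (use ev in eventually_elim, simp add: trunc)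
  qed
  then show ?thesis unfolding cauchy_pv_exists_def by blast
qed

end
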